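(* Let $G$ be a group, let $N\geq 1$ be an integer and let $\chi_1,\ldots,\chi_N$ be $N$ distinct characters of $G$. The solutions $f,h,h_1,\ldots,h_N:G\to\mathbb{C}$ of the functional equation $$f(xy)=f(x)h(y)+\sum_{j=1}^{N}\chi_j(x)h_j(y)\quad\text{for all }x,y\in G$$ are exactly the tuples $(f,h,h_1,\ldots,h_N)$ of one of the following forms: (1) $f=\sum_{j=1}^{N}\alpha_j\chi_j$, $h$ arbitrary and $h_j=\alpha_j\chi_j-\alpha_jh$ for all $j=1,\ldots,N$, where $\alpha_1,\ldots,\alpha_N\in\mathbb{C}$ are constants; (2) $f=a\chi+\sum_{j=1}^{N}\varphi_{\chi,\chi_j}$, $h=\chi$ and $h_j=\varphi_{\chi,\chi_j}$ for all $j=1,\ldots,N$, where $\chi$ is a character of $G$, $a\in\mathbb{C}$ is a constant, and for each $j$ the function $\varphi_{\chi,\chi_j}:G\to\mathbb{C}$ is a solution of $\varphi_{\chi,\chi_j}(xy)=\varphi_{\chi,\chi_j}(x)\chi(y)+\chi_j(x)\varphi_{\chi,\chi_j}(y)$ for all $x,y\in G$.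
   Context: A character of a group $G$ is a homomorphism from $G$ into the multiplicative group $\mathbb{C}^*$ of nonzero complex numbers. "Arbitrary" means an arbitrary function $G\to\mathbb{C}$. For each $j$, $\varphi_{\chi,\chi_j}$ denotes one and the same function at each occurrence. *)

theory Defs
  imports Complex_Main "HOL-Algebra.Group"
begin

definition complex_mult_group :: "complex monoid" where
  "complex_mult_group = \<lparr>carrier = - {0}, mult = (*), one = 1\<rparr>"

text \<open>Functions on a group \<open>G\<close> are total HOL functions whose values outside \<open>carrier G\<close> are
  irrelevant; hence equality of functions on \<open>G\<close> always means equality on \<open>carrier G\<close>.\<close>

definition character :: "('a, 'b) monoid_scheme \<Rightarrow> ('a \<Rightarrow> complex) \<Rightarrow> bool" where
  "character G \<chi> \<longleftrightarrow> \<chi> \<in> hom G complex_mult_group"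

end

theory Submission
  imports Defs
begin

text \<open>If \<open>f\<close> is a linear combination of the characters \<open>\<chi>\<^sub>j\<close>, comparing coefficients in the equation gives
  form (1), because distinct characters are linearly independent. Otherwise \<open>f\<close> and the \<open>\<chi>\<^sub>j\<close>
  are jointly linearly independent; expanding \<open>f (xyz)\<close> by associativity in two ways and comparing
  coefficients shows that \<open>h\<close> is multiplicative and that
  \<open>h\<^sub>j (yz) = h\<^sub>j y h z + \<chi>\<^sub>j y h\<^sub>j z\<close>, which is form (2) with \<open>a = f 1\<close>.\<close>

lemma character_mult:
  "\<lbrakk>character G \<chi>; x \<in> carrier G; y \<in> carrier G\<rbrakk> \<Longrightarrow> \<chi> (x \<otimes>\<^bsub>G\<^esub> y) = \<chi> x * \<chi> y"
  by (auto simp: character_def complex_mult_group_def hom_def)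

lemma character_nonzero: "\<lbrakk>character G \<chi>; x \<in> carrier G\<rbrakk> \<Longrightarrow> \<chi> x \<noteq> 0"
  by (auto simp: character_def complex_mult_group_def hom_def)

lemma (in monoid) character_one:
  assumes "character G \<chi>"
  shows "\<chi> \<one> = 1"
  using character_mult[OF assms one_closed one_closed] character_nonzero[OF assms one_closed]
  by simp

text \<open>Values are nonzero because
  \<open>\<chi> x * \<chi> (inv x) = \<chi> \<one> = 1\<close>.\<close>

lemma (in group) characterI:
  assumes mult: "\<And>x y. \<lbrakk>x \<in> carrier G; y \<in> carrier G\<rbrakk> \<Longrightarrow> \<chi> (x \<otimes> y) = \<chi> x * \<chi> y"
    and one: "\<chi> \<one> = 1"
  shows "character G \<chi>"
proof -
  have "\<chi> x \<noteq> 0" if "x \<in> carrier G" for x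
    using mult[OF that inv_closed[OF that]] that one by auto
  then show ?thesis
    by (auto simp: character_def complex_mult_group_def hom_def mult)
qed

text \<open>Dedekind's argument, by induction on the index set: a linear relation is turned into one
  with a character fewer and new coefficients, hence the induction over arbitrary
  \<open>c\<close>.\<close>

lemma (in monoid) characters_linearly_independent:
  fixes \<chi> :: "'i \<Rightarrow> 'a \<Rightarrow> complex"
  assumes "finite J"
    and "\<forall>j\<in>J. character G (\<chi> j)"
    and "\<forall>i\<in>J. \<forall>j\<in>J. i \<noteq> j \<longrightarrow> (\<exists>x\<in>carrier G. \<chi> i x \<noteq> \<chi> j x)"
    and "\<forall>x\<in>carrier G. (\<Sum>j\<in>J. c j * \<chi> j x) = 0"
  shows "\<forall>j\<in>J. c j = 0"
  using assms
proof (induction J arbitrary: c rule: finite_induct)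
  case empty
  then show ?case by simp
next
  case (insert i J)
  have sum0: "c i * \<chi> i x + (\<Sum>j\<in>J. c j * \<chi> j x) = 0" if "x \<in> carrier G" for x
    using insert.prems(3) insert.hyps that by simp
  have J0: "c j = 0" if j: "j \<in> J" for j
  proof -
    obtain y where y: "y \<in> carrier G" "\<chi> j y \<noteq> \<chi> i y"
      using insert.prems(2) insert.hyps(2) j by (metis insertCI)
    \<comment> \<open>Subtracting \<open>\<chi>\<^sub>i y\<close> times the relation at \<open>x\<close> from the relation at \<open>xy\<close> eliminates \<open>\<chi>\<^sub>i\<close>.\<close>
    have "(\<Sum>k\<in>J. (c k * (\<chi> k y - \<chi> i y)) * \<chi> k x) = 0" if x: "x \<in> carrier G" for x
    proof -
      have "(\<Sum>k\<in>J. (c k * (\<chi> k y - \<chi> i y)) * \<chi> k x)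
          = (\<Sum>k\<in>J. c k * \<chi> k (x \<otimes> y)) - \<chi> i y * (\<Sum>k\<in>J. c k * \<chi> k x)"
        unfolding sum_distrib_left sum_subtractf[symmetric]
        by (rule sum.cong) (use insert.prems(1) x y in \<open>simp_all add: character_mult algebra_simps\<close>)
      also have "\<dots> = - (c i * \<chi> i (x \<otimes> y)) + \<chi> i y * (c i * \<chi> i x)"
        using sum0[OF x] sum0[OF m_closed[OF x y(1)]] by (simp add: add_eq_0_iff2)
      also have "\<dots> = 0"
        using insert.prems(1) x y by (simp add: character_mult)
      finally show ?thesis .
    qed
    \<comment> \<open>At \<open>k = j\<close> the second factor is nonzero by the choice of
      \<open>y\<close>, which leaves \<open>c j = 0\<close>.\<close>
    then have "\<forall>k\<in>J. c k * (\<chi> k y - \<chi> i y) = 0"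
      using insert.prems by (intro insert.IH) auto
    with j y(2) show ?thesis by auto
  qed
  moreover have "c i = 0"
    using sum0[OF one_closed] J0 insert.prems(1) by (simp add: character_one)
  ultimately show ?case by simp
qed

theorem theorem5p1:
  fixes G :: "('a, 'b) monoid_scheme" (structure)
    and N :: nat
    and \<chi>s :: "nat \<Rightarrow> 'a \<Rightarrow> complex"
    and f h :: "'a \<Rightarrow> complex"
    and hs :: "nat \<Rightarrow> 'a \<Rightarrow> complex"
  assumes "group G"
    and "N \<ge> 1"
    and "\<forall>j\<in>{1..N}. character G (\<chi>s j)"
    and "\<forall>i\<in>{1..N}. \<forall>j\<in>{1..N}. i \<noteq> j \<longrightarrow> (\<exists>x\<in>carrier G. \<chi>s i x \<noteq> \<chi>s j x)"
  shows "(\<forall>x\<in>carrier G. \<forall>y\<in>carrier G.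
            f (x \<otimes> y) = f x * h y + (\<Sum>j=1..N. \<chi>s j x * hs j y))
    \<longleftrightarrow>
      (\<exists>\<alpha> :: nat \<Rightarrow> complex.
          (\<forall>x\<in>carrier G. f x = (\<Sum>j=1..N. \<alpha> j * \<chi>s j x)) \<and>
          (\<forall>j\<in>{1..N}. \<forall>x\<in>carrier G. hs j x = \<alpha> j * \<chi>s j x - \<alpha> j * h x))
    \<or> (\<exists>(\<chi> :: 'a \<Rightarrow> complex) (a :: complex) (\<phi> :: nat \<Rightarrow> 'a \<Rightarrow> complex).
          character G \<chi> \<and>
          (\<forall>j\<in>{1..N}. \<forall>x\<in>carrier G. \<forall>y\<in>carrier G.
              \<phi> j (x \<otimes> y) = \<phi> j x * \<chi> y + \<chi>s j x * \<phi> j y) \<and>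
          (\<forall>x\<in>carrier G. f x = a * \<chi> x + (\<Sum>j=1..N. \<phi> j x)) \<and>
          (\<forall>x\<in>carrier G. h x = \<chi> x) \<and>
          (\<forall>j\<in>{1..N}. \<forall>x\<in>carrier G. hs j x = \<phi> j x))"
proof -
  interpret group G by fact
  have char: "character G (\<chi>s j)" if "j \<in> {1..N}" for j
    using assms(3) that by blast
  have indep: "\<forall>j\<in>{1..N}. c j = 0" if "\<forall>x\<in>carrier G. (\<Sum>j=1..N. c j * \<chi>s j x) = 0" for c
    using characters_linearly_independent[OF _ assms(3,4) that] by simp
  show ?thesis (is "?eq \<longleftrightarrow> ?form1 \<or> ?form2")
  proof
    assume eq: ?eq
    show "?form1 \<or> ?form2"
    proof (cases "\<exists>\<alpha>. \<forall>x\<in>carrier G. f x = (\<Sum>j=1..N. \<alpha> j * \<chi>s j x)")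
      case True
      then obtain \<alpha> where f: "\<And>x. x \<in> carrier G \<Longrightarrow> f x = (\<Sum>j=1..N. \<alpha> j * \<chi>s j x)"
        by blast
      have "hs j y = \<alpha> j * \<chi>s j y - \<alpha> j * h y" if y: "y \<in> carrier G" and j: "j \<in> {1..N}" for y j
      proof -
        \<comment> \<open>With \<open>y\<close> fixed and \<open>f\<close> expanded, the equation is
          a linear relation in \<open>x\<close> between the characters, so every coefficient must
          vanish.\<close>
        have "(\<Sum>j=1..N. (\<alpha> j * \<chi>s j y - \<alpha> j * h y - hs j y) * \<chi>s j x) = 0"
          if x: "x \<in> carrier G" for x
        proof -
          have "(\<Sum>j=1..N. (\<alpha> j * \<chi>s j y - \<alpha> j * h y - hs j y) * \<chi>s j x)
              = (\<Sum>j=1..N. \<alpha> j * \<chi>s j (x \<otimes> y)) - (\<Sum>j=1..N. \<alpha> j * \<chi>s j x) * h y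
                - (\<Sum>j=1..N. \<chi>s j x * hs j y)"
            unfolding sum_distrib_right sum_subtractf[symmetric]
            by (rule sum.cong) (use x y in \<open>simp_all add: char character_mult algebra_simps\<close>)
          also have "\<dots> = 0"
            unfolding f[OF x, symmetric] f[OF m_closed[OF x y], symmetric] using eq x y by simp
          finally show ?thesis .
        qed
        with j show ?thesis
          using indep[of "\<lambda>j. \<alpha> j * \<chi>s j y - \<alpha> j * h y - hs j y"] by auto
      qed
      with f show ?thesis by blast
    next
      case False
      \<comment> \<open>A relation with \<open>b \<noteq> 0\<close> could be solved for
        \<open>f\<close>, making it a combination of the characters; with \<open>b = 0\<close> only
        the characters remain.\<close>
      have indep_f: "b = 0 \<and> (\<forall>j\<in>{1..N}. c j = 0)"
        if rel: "\<And>x. x \<in> carrier G \<Longrightarrow> b * f x + (\<Sum>j=1..N. c j * \<chi>s j x) = 0" for b c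
      proof -
        have "b = 0"
        proof (rule ccontr)
          assume "b \<noteq> 0"
          have "f x = (\<Sum>j=1..N. (- c j / b) * \<chi>s j x)" if "x \<in> carrier G" for x
          proof -
            have "(\<Sum>j=1..N. (- c j / b) * \<chi>s j x) = - (\<Sum>j=1..N. c j * \<chi>s j x) / b"
              unfolding sum_negf[symmetric] sum_divide_distrib by (rule sum.cong) simp_all
            also have "- (\<Sum>j=1..N. c j * \<chi>s j x) = b * f x"
              using rel[OF that] by algebra
            finally show ?thesis
              using \<open>b \<noteq> 0\<close> by simp
          qed
          then have "\<exists>\<alpha>. \<forall>x\<in>carrier G. f x = (\<Sum>j=1..N. \<alpha> j * \<chi>s j x)"
            by (intro exI[of _ "\<lambda>j. - c j / b"] ballI)
          with False show False ..
        qed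
        moreover have "\<forall>j\<in>{1..N}. c j = 0"
          by (rule indep) (use rel \<open>b = 0\<close> in simp)
        ultimately show ?thesis ..
      qed
      have mult: "h (y \<otimes> z) - h y * h z = 0
          \<and> (\<forall>j\<in>{1..N}. hs j (y \<otimes> z) - (hs j y * h z + \<chi>s j y * hs j z) = 0)"
        if y: "y \<in> carrier G" and z: "z \<in> carrier G" for y z
      proof (rule indep_f)
        fix x assume x: "x \<in> carrier G"
        \<comment> \<open>Splitting \<open>\<chi>s j (x \<otimes> y)\<close> moves
          \<open>\<chi>s j y\<close> into the coefficient, so that only \<open>\<chi>s j x\<close>
          depends on \<open>x\<close>.\<close>
        have "(\<Sum>j=1..N. (hs j (y \<otimes> z) - (hs j y * h z + \<chi>s j y * hs j z)) * \<chi>s j x)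
            = (\<Sum>j=1..N. \<chi>s j x * hs j (y \<otimes> z)) - (\<Sum>j=1..N. \<chi>s j x * hs j y) * h z
              - (\<Sum>j=1..N. \<chi>s j (x \<otimes> y) * hs j z)"
          unfolding sum_distrib_right sum_subtractf[symmetric]
          by (rule sum.cong) (use x y in \<open>simp_all add: char character_mult algebra_simps\<close>)
        moreover have "f (x \<otimes> (y \<otimes> z)) = f x * h (y \<otimes> z) + (\<Sum>j=1..N. \<chi>s j x * hs j (y \<otimes> z))"
          using eq x y z by blast
        moreover have "f (x \<otimes> (y \<otimes> z)) = f (x \<otimes> y) * h z + (\<Sum>j=1..N. \<chi>s j (x \<otimes> y) * hs j z)"
          using eq x y z by (metis m_assoc m_closed)
        moreover have "f (x \<otimes> y) = f x * h y + (\<Sum>j=1..N. \<chi>s j x * hs j y)"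
          using eq x y by blast
        ultimately show "(h (y \<otimes> z) - h y * h z) * f x
            + (\<Sum>j=1..N. (hs j (y \<otimes> z) - (hs j y * h z + \<chi>s j y * hs j z)) * \<chi>s j x) = 0"
          by algebra
      qed
      \<comment> \<open>Multiplicativity alone would allow \<open>h\<close> to vanish identically;
        the equation at \<open>y = \<one>\<close> excludes this.\<close>
      have "h \<one> - 1 = 0 \<and> (\<forall>j\<in>{1..N}. hs j \<one> = 0)"
      proof (rule indep_f)
        fix x assume x: "x \<in> carrier G"
        then have "f (x \<otimes> \<one>) = f x * h \<one> + (\<Sum>j=1..N. \<chi>s j x * hs j \<one>)"
          using eq by blast
        moreover have "(\<Sum>j=1..N. hs j \<one> * \<chi>s j x) = (\<Sum>j=1..N. \<chi>s j x * hs j \<one>)"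
          by (simp only: mult.commute)
        ultimately show "(h \<one> - 1) * f x + (\<Sum>j=1..N. hs j \<one> * \<chi>s j x) = 0"
          unfolding r_one[OF x] by algebra
      qed
      then have "character G h"
        using mult by (intro characterI) auto
      \<comment> \<open>With \<open>\<one>\<close> as first argument every factor
        \<open>\<chi>s j \<one>\<close> is 1. The functions \<open>h\<close> and \<open>hs\<close>
        themselves serve as \<chi> and \<phi> in form (2).\<close>
      moreover have "f x = f \<one> * h x + (\<Sum>j=1..N. hs j x)" if x: "x \<in> carrier G" for x
      proof -
        have "f (\<one> \<otimes> x) = f \<one> * h x + (\<Sum>j=1..N. \<chi>s j \<one> * hs j x)"
          using eq x by blast
        with x show ?thesis by (simp add: char character_one)
      qed
      moreover have "\<forall>j\<in>{1..N}. \<forall>x\<in>carrier G. \<forall>y\<in>carrier G.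
          hs j (x \<otimes> y) = hs j x * h y + \<chi>s j x * hs j y"
        using mult by simp
      ultimately show ?thesis by blast
    qed
  next
    assume "?form1 \<or> ?form2"
    then show ?eq
    proof
      assume ?form1
      then obtain \<alpha> where f: "\<And>x. x \<in> carrier G \<Longrightarrow> f x = (\<Sum>j=1..N. \<alpha> j * \<chi>s j x)"
        and hs: "\<And>j x. \<lbrakk>j \<in> {1..N}; x \<in> carrier G\<rbrakk> \<Longrightarrow> hs j x = \<alpha> j * \<chi>s j x - \<alpha> j * h x"
        by blast
      show ?eq
      proof (intro ballI)
        fix x y assume x: "x \<in> carrier G" and y: "y \<in> carrier G"
        \<comment> \<open>The identity holds termwise: \<open>\<alpha> j * \<chi>s j x * h y\<close>
          from \<open>f x * h y\<close> cancels against the same term in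
          \<open>\<chi>s j x * hs j y\<close>, which is why \<open>h\<close> is free.\<close>
        show "f (x \<otimes> y) = f x * h y + (\<Sum>j=1..N. \<chi>s j x * hs j y)"
          unfolding f[OF x] f[OF m_closed[OF x y]] sum_distrib_right sum.distrib[symmetric]
          by (rule sum.cong) (use x y in \<open>simp_all add: hs char character_mult algebra_simps\<close>)
      qed
    next
      assume ?form2
      then obtain \<chi> a \<phi> where \<chi>: "character G \<chi>"
        and \<phi>: "\<And>j x y. \<lbrakk>j \<in> {1..N}; x \<in> carrier G; y \<in> carrier G\<rbrakk>
            \<Longrightarrow> \<phi> j (x \<otimes> y) = \<phi> j x * \<chi> y + \<chi>s j x * \<phi> j y"
        and f: "\<And>x. x \<in> carrier G \<Longrightarrow> f x = a * \<chi> x + (\<Sum>j=1..N. \<phi> j x)"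
        and h: "\<And>x. x \<in> carrier G \<Longrightarrow> h x = \<chi> x"
        and hs: "\<And>j x. \<lbrakk>j \<in> {1..N}; x \<in> carrier G\<rbrakk> \<Longrightarrow> hs j x = \<phi> j x"
        by blast
      show ?eq
      proof (intro ballI)
        fix x y assume x: "x \<in> carrier G" and y: "y \<in> carrier G"
        \<comment> \<open>Sum of the equations for the \<open>\<phi> j\<close>; the remaining term
          \<open>a * \<chi> (x \<otimes> y)\<close> factors because \<chi> is a character.\<close>
        have "(\<Sum>j=1..N. \<phi> j (x \<otimes> y)) = (\<Sum>j=1..N. \<phi> j x) * \<chi> y + (\<Sum>j=1..N. \<chi>s j x * hs j y)"
          unfolding sum_distrib_right sum.distrib[symmetric]
          by (rule sum.cong) (use x y in \<open>simp_all add: \<phi> hs\<close>)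
        with x y show "f (x \<otimes> y) = f x * h y + (\<Sum>j=1..N. \<chi>s j x * hs j y)"
          by (simp add: f h character_mult[OF \<chi>] algebra_simps)
      qed
    qed
  qed
qed

end
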